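(* Let $k\in\mathbb{N}\setminus\{0\}$. Any lattice $\mathcal{L}$ of regular subsets of $\mathbb{N}$ which is closed under decrement is also closed under $k$-quotient; that is, $L\in\mathcal{L}$ implies $L\div k=\{x\in\mathbb{N}\mid kx\in L\}\in\mathcal{L}$.
   Context: $\mathbb{N}=\{0,1,2,\ldots\}$. A lattice over a set $X$ is any non empty family of subsets of $X$ closed under (binary) union and intersection. For $L\subseteq\mathbb{N}$ and $i\in\mathbb{N}$, $L-i=\{x\in\mathbb{N}\mid x+i\in L\}$; a family $\mathcal{L}$ of subsets of $\mathbb{N}$ is closed under decrement if $L\in\mathcal{L}$ implies $L-1\in\mathcal{L}$. A subset of $\mathbb{N}$ is regular if it is recognized by a finite automaton in unary notation; equivalently, if it is the union of a finite set with finitely many arithmetic progressions $a+r\mathbb{N}$ ($a,r\in\mathbb{N}$, $r\geq1$). *)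

theory Defs
  imports Main
begin

definition set_lattice :: "'a set \<Rightarrow> 'a set set \<Rightarrow> bool" where
  "set_lattice X F \<longleftrightarrow>
     F \<noteq> {} \<and> F \<subseteq> Pow X \<and> (\<forall>A\<in>F. \<forall>B\<in>F. A \<union> B \<in> F \<and> A \<inter> B \<in> F)"

definition shift_down :: "nat set \<Rightarrow> nat \<Rightarrow> nat set" where
  "shift_down L i = {x. x + i \<in> L}"

definition quotient_by :: "nat set \<Rightarrow> nat \<Rightarrow> nat set" where
  "quotient_by L k = {x. k * x \<in> L}"

definition closed_under_decrement :: "nat set set \<Rightarrow> bool" where
  "closed_under_decrement F \<longleftrightarrow> (\<forall>L\<in>F. shift_down L 1 \<in> F)"

definition closed_under_quotient :: "nat \<Rightarrow> nat set set \<Rightarrow> bool" where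
  "closed_under_quotient k F \<longleftrightarrow> (\<forall>L\<in>F. quotient_by L k \<in> F)"

record ('q, 'a) automaton =
  states :: "'q set"
  initial :: 'q
  accepting :: "'q set"
  step :: "'a \<Rightarrow> 'q \<Rightarrow> 'q"

definition finite_automaton :: "('q, 'a) automaton \<Rightarrow> bool" where
  "finite_automaton M \<longleftrightarrow>
     finite (states M) \<and> initial M \<in> states M \<and> accepting M \<subseteq> states M \<and>
     (\<forall>a. \<forall>q\<in>states M. step M a q \<in> states M)"

definition accepts :: "('q, 'a) automaton \<Rightarrow> 'a list \<Rightarrow> bool" where
  "accepts M w \<longleftrightarrow> fold (step M) w (initial M) \<in> accepting M"

(* Unary notation: n is the word of length n over the one-letter alphabet unit.
   Taking natural numbers as states is no restriction, as the state set is finite. *)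
definition regular_set :: "nat set \<Rightarrow> bool" where
  "regular_set L \<longleftrightarrow>
     (\<exists>M :: (nat, unit) automaton. finite_automaton M \<and> L = {n. accepts M (replicate n ())})"

definition arith_prog :: "nat \<Rightarrow> nat \<Rightarrow> nat set" where
  "arith_prog a r = {a + r * n | n. True}"

lemma fold_replicate: "fold f (replicate n x) s = (f x ^^ n) s"
  by (induction n arbitrary: s) (simp_all add: funpow_swap1)

lemma regular_set_imp_periodic:
  assumes "regular_set L"
  shows "\<exists>N p. p \<ge> 1 \<and> (\<forall>n\<ge>N. n + p \<in> L \<longleftrightarrow> n \<in> L)"
proof -
  obtain M :: "(nat, unit) automaton" where M: "finite_automaton M"
    and L: "L = {n. accepts M (replicate n ())}"
    using assms by (auto simp: regular_set_def)
  define f where "f = step M ()"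
  define s where "s n = (f ^^ n) (initial M)" for n
  have st: "s n \<in> states M" for n
    using M by (induction n) (auto simp: s_def f_def finite_automaton_def)
  have "finite (range s)"
    using M st by (meson finite_automaton_def finite_subset image_subsetI)
  then have "\<not> inj s"
    using finite_imageD infinite_UNIV_nat by blast
  then obtain i j where ij: "i < j" "s i = s j"
    by (metis injI linorder_neqE_nat)
  have per: "s (n + (j - i)) = s n" if "n \<ge> i" for n
  proof -
    have "s (n + (j - i)) = (f ^^ (n - i)) (s j)"
    proof -
      have "n + (j - i) = (n - i) + j" using ij that by simp
      then show ?thesis by (simp only: s_def funpow_add o_apply)
    qed
    also have "\<dots> = (f ^^ (n - i)) (s i)" using ij by simp
    also have "\<dots> = s n"
    proof -
      have "n = (n - i) + i" using that by simp
      then show ?thesis by (metis s_def funpow_add o_apply)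
    qed
    finally show ?thesis .
  qed
  have "n \<in> L \<longleftrightarrow> s n \<in> accepting M" for n
    by (simp add: L accepts_def fold_replicate s_def f_def)
  then have "\<forall>n\<ge>i. n + (j - i) \<in> L \<longleftrightarrow> n \<in> L"
    using per by simp
  then show ?thesis
    using ij by (intro exI[of _ i] exI[of _ "j - i"]) auto
qed

lemma periodic_imp_regular_set:
  assumes p: "p \<ge> 1" and per: "\<And>n. n \<ge> N \<Longrightarrow> n + p \<in> L \<longleftrightarrow> n \<in> L"
  shows "regular_set L"
proof -
  define f where "f q = (if q + 1 = N + p then N else q + 1)" for q
  define M :: "(nat, unit) automaton" where
    "M = \<lparr>states = {..<N + p}, initial = 0, accepting = L \<inter> {..<N + p}, step = (\<lambda>_. f)\<rparr>"
  have fa: "finite_automaton M"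
    using p by (auto simp: finite_automaton_def M_def f_def)
  have inv: "(f ^^ n) 0 < N + p \<and> (\<exists>m. n = (f ^^ n) 0 + m * p \<and> (m > 0 \<longrightarrow> (f ^^ n) 0 \<ge> N))" for n
  proof (induction n)
    case 0
    then show ?case using p by auto
  next
    case (Suc n)
    define q where "q = (f ^^ n) 0"
    from Suc obtain m where q: "q < N + p" and m: "n = q + m * p" "m > 0 \<longrightarrow> q \<ge> N"
      unfolding q_def by blast
    have e: "(f ^^ Suc n) 0 = f q" by (simp add: q_def)
    show ?case
    proof (cases "q + 1 = N + p")
      case True
      then have "Suc n = N + Suc m * p" using m by simp
      then show ?thesis unfolding e using True p by (auto simp: f_def intro!: exI[of _ "Suc m"])
    next
      case False
      then show ?thesis unfolding e using q m by (auto simp: f_def intro!: exI[of _ m])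
    qed
  qed
  have perm: "q + m * p \<in> L \<longleftrightarrow> q \<in> L" if "q \<ge> N" for q m
  proof (induction m)
    case (Suc m)
    have "q + Suc m * p = (q + m * p) + p" by simp
    then show ?case using per[of "q + m * p"] Suc that by (metis trans_le_add1)
  qed simp
  have "n \<in> L \<longleftrightarrow> (f ^^ n) 0 \<in> L" for n
    using inv[of n] perm by (metis add.right_neutral gr0I mult_0)
  then have "n \<in> L \<longleftrightarrow> accepts M (replicate n ())" for n
    using inv[of n] by (simp add: accepts_def fold_replicate M_def)
  then show ?thesis
    using fa by (auto simp: regular_set_def)
qed

lemma regular_set_iff_arith_prog:
  "regular_set L \<longleftrightarrow>
     (\<exists>A P. finite A \<and> finite P \<and> (\<forall>(a, r)\<in>P. r \<ge> 1) \<and> L = A \<union> (\<Union>(a, r)\<in>P. arith_prog a r))"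
  (is "_ \<longleftrightarrow> ?R")
proof
  assume "regular_set L"
  then obtain N p where p: "p \<ge> 1" and per: "\<forall>n\<ge>N. n + p \<in> L \<longleftrightarrow> n \<in> L"
    using regular_set_imp_periodic by blast
  have perm: "q + p * m \<in> L \<longleftrightarrow> q \<in> L" if "q \<ge> N" for q m
  proof (induction m)
    case (Suc m)
    have "q + p * Suc m = (q + p * m) + p" by simp
    then show ?case using per Suc that by (metis trans_le_add1)
  qed simp
  define P where "P = (L \<inter> {N..<N + p}) \<times> {p}"
  have "L = (L \<inter> {..<N}) \<union> (\<Union>(a, r)\<in>P. arith_prog a r)" (is "_ = ?S")
  proof (intro set_eqI iffI)
    fix n assume n: "n \<in> L"
    show "n \<in> ?S"
    proof (cases "n < N")
      case False
      define a where "a = N + (n - N) mod p"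
      have a: "n = a + p * ((n - N) div p)" using False by (simp add: a_def)
      moreover have "N \<le> a" "a < N + p" using p by (auto simp: a_def)
      moreover have "a \<in> L" using perm n a \<open>N \<le> a\<close> by metis
      ultimately have "(a, p) \<in> P" "n \<in> arith_prog a p"
        by (auto simp: P_def arith_prog_def)
      then show ?thesis by blast
    qed (use n in auto)
  qed (use perm in \<open>auto simp: P_def arith_prog_def\<close>)
  moreover have "finite (L \<inter> {..<N})" "finite P" "\<forall>(a, r)\<in>P. r \<ge> 1"
    using p by (auto simp: P_def)
  ultimately show ?R by blast
next
  assume ?R
  then obtain A P where fin: "finite A" "finite P" and r: "\<forall>(a, r)\<in>P. r \<ge> 1"
    and L: "L = A \<union> (\<Union>(a, r)\<in>P. arith_prog a r)" by blast
  define p where "p = (\<Prod>x\<in>P. snd x)"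
  have p: "p \<ge> 1"
    unfolding p_def by (rule prod_ge_1) (use r in auto)
  obtain N where N: "\<forall>x \<in> A \<union> fst ` P. x < N"
    using fin finite_nat_set_iff_bounded[of "A \<union> fst ` P"] by auto
  have "n + p \<in> arith_prog a s \<longleftrightarrow> n \<in> arith_prog a s" if "n \<ge> N" "(a, s) \<in> P" for n a s
  proof -
    have "s dvd p"
      unfolding p_def using dvd_prodI[OF fin(2) that(2), of snd] by simp
    moreover have "n \<ge> a"
    proof -
      have "a \<in> fst ` P" using that(2) by (metis fst_conv image_eqI)
      then show ?thesis using N that(1) by (meson UnI2 le_trans less_imp_le)
    qed
    moreover have "x \<in> arith_prog a s \<longleftrightarrow> s dvd (x - a)" if "x \<ge> a" for x
      using that by (auto simp: arith_prog_def dvd_def) (metis le_add_diff_inverse)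
    moreover have "n + p - a = (n - a) + p" using \<open>n \<ge> a\<close> by simp
    ultimately show ?thesis by (metis dvd_add_left_iff trans_le_add1)
  qed
  moreover have "n \<notin> A" if "n \<ge> N" for n using N that by (meson UnI1 leD)
  ultimately have "n + p \<in> L \<longleftrightarrow> n \<in> L" if "n \<ge> N" for n
    using that unfolding L by fastforce
  then show "regular_set L" using p periodic_imp_regular_set by blast
qed

end

theory Submission
  imports Defs
begin

text \<open>
  A regular set L has only finitely many shifts L - i, so for every a the set
  S(a), the intersection of the shifts of L that contain a, is a finite intersection, and there
  are finitely many sets S(a). The quotient of L by k is the union of the S(a) with k a in L.
  Indeed, x in S(a) means that a + i in L implies x + i in L for all i; applying this k times
  replaces the summands of a + ... + a in L by x one after the other, so that k x is in L.
  An empty quotient is the intersection of all shifts, because x lies in the shift by (k - 1) x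
  only if k x is in L.
\<close>

lemma set_lattice_Union:
  assumes "set_lattice X F" "finite G" "G \<noteq> {}" "G \<subseteq> F"
  shows "\<Union>G \<in> F"
  using assms(2-4)
  by (induction rule: finite_ne_induct) (use assms(1) in \<open>auto simp: set_lattice_def\<close>)

lemma set_lattice_Inter:
  assumes "set_lattice X F" "finite G" "G \<noteq> {}" "G \<subseteq> F"
  shows "\<Inter>G \<in> F"
  using assms(2-4)
  by (induction rule: finite_ne_induct) (use assms(1) in \<open>auto simp: set_lattice_def\<close>)

lemma shift_down_mem:
  assumes "closed_under_decrement F" "L \<in> F"
  shows "shift_down L i \<in> F"
proof (induction i)
  case 0
  then show ?case using assms(2) by (simp add: shift_down_def)
next
  case (Suc i)
  have "shift_down L (Suc i) = shift_down (shift_down L i) 1"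
    by (simp add: shift_down_def)
  then show ?case using Suc assms(1) by (metis closed_under_decrement_def)
qed

text \<open>Membership in \<open>L\<close> is eventually periodic, so a shift by \<open>i\<close>
  with \<open>i \<ge> N + p\<close> equals the shift by \<open>i - p\<close>; descent ends below
  \<open>N + p\<close>.\<close>

lemma finite_range_shift_down:
  assumes "regular_set L"
  shows "finite (range (shift_down L))"
proof -
  obtain N p where p: "p \<ge> 1" and per: "\<forall>n\<ge>N. n + p \<in> L \<longleftrightarrow> n \<in> L"
    using regular_set_imp_periodic[OF assms] by blast
  have "shift_down L i \<in> shift_down L ` {..<N + p}" for i
  proof (induction i rule: less_induct)
    case (less i)
    show ?case
    proof (cases "i < N + p")
      case False
      have "shift_down L i = shift_down L (i - p)"
      proof -
        have "x + i \<in> L \<longleftrightarrow> x + (i - p) \<in> L" for x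
          using per[rule_format, of "x + (i - p)"] False by simp
        then show ?thesis by (simp add: shift_down_def)
      qed
      then show ?thesis using less[of "i - p"] False p by simp
    qed simp
  qed
  then show ?thesis by (meson finite_imageI finite_lessThan finite_subset image_subsetI)
qed

lemma mult_mem_transfer:
  fixes k a x :: nat
  assumes k: "k \<noteq> 0" and a: "k * a \<in> L" and imp: "\<And>i. a + i \<in> L \<Longrightarrow> x + i \<in> L"
  shows "k * x \<in> L"
proof -
  have "j * x + (k - j) * a \<in> L" if "j \<le> k" for j
    using that
  proof (induction j)
    case 0
    then show ?case using a by simp
  next
    case (Suc j)
    then have "k - j = Suc (k - Suc j)" by simp
    \<comment> \<open>One copy of \<open>a\<close> is split off; the other summands serve as the
      \<open>i\<close> in \<open>imp\<close>.\<close>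
    then have "a + (j * x + (k - Suc j) * a) \<in> L"
      using Suc by (simp add: ac_simps)
    from imp[OF this] show ?case by (simp add: ac_simps)
  qed
  from this[of k] show ?thesis by simp
qed

theorem theorem2p1:
  fixes k :: nat and \<L> :: "nat set set"
  assumes "k \<noteq> 0"
    and "set_lattice UNIV \<L>"
    and "\<forall>L\<in>\<L>. regular_set L"
    and "closed_under_decrement \<L>"
  shows "closed_under_quotient k \<L>"
  unfolding closed_under_quotient_def
proof
  fix L assume L: "L \<in> \<L>"
  define R where "R = range (shift_down L)"
  have R: "finite R" "R \<subseteq> \<L>" "R \<noteq> {}"
    using finite_range_shift_down shift_down_mem[OF assms(4) L] assms(3) L by (auto simp: R_def)
  define S where "S a = \<Inter>{A \<in> R. a \<in> A}" for a
  have S_iff: "x \<in> S a \<longleftrightarrow> (\<forall>i. a + i \<in> L \<longrightarrow> x + i \<in> L)" for x a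
    by (auto simp: S_def R_def shift_down_def)
  show "quotient_by L k \<in> \<L>"
  \<comment> \<open>A lattice need not contain the empty set, so an empty union needs separate
    treatment.\<close>
  proof (cases "quotient_by L k = {}")
    case True
    have "x \<notin> \<Inter>R" for x
    proof
      assume "x \<in> \<Inter>R"
      then have "x + (k - 1) * x \<in> L" by (auto simp: R_def shift_down_def)
      then have "k * x \<in> L" using assms(1) by (cases k) auto
      then show False using True by (auto simp: quotient_by_def)
    qed
    then have "quotient_by L k = \<Inter>R" using True by blast
    then show ?thesis using set_lattice_Inter[OF assms(2) R(1,3,2)] by simp
  next
    case False
    have mem: "S a \<in> \<L>" if "a \<in> quotient_by L k" for a
    proof -
      \<comment> \<open>The shift by \<open>(k - 1) * a\<close> contains \<open>a\<close>, so
        \<open>S a\<close> is not an empty intersection.\<close>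
      have "a + (k - 1) * a \<in> L"
        using that assms(1) by (cases k) (auto simp: quotient_by_def)
      then have "{A \<in> R. a \<in> A} \<noteq> {}" by (auto simp: R_def shift_down_def)
      then show ?thesis
        unfolding S_def using R by (intro set_lattice_Inter[OF assms(2)]) auto
    qed
    \<comment> \<open>The quotient may be infinite, but each \<open>S a\<close> is determined by a
      subfamily of the finite \<open>R\<close>.\<close>
    have "S ` quotient_by L k \<subseteq> Inter ` Pow R" by (auto simp: S_def)
    then have "finite (S ` quotient_by L k)" using R(1) by (meson finite_Pow_iff finite_imageI finite_subset)
    then have "\<Union>(S ` quotient_by L k) \<in> \<L>"
      using mem False by (intro set_lattice_Union[OF assms(2)]) auto
    \<comment> \<open>One inclusion is the transfer from \<open>a\<close> to \<open>x\<close>; the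
      other holds since \<open>a \<in> S a\<close>.\<close>
    moreover have "\<Union>(S ` quotient_by L k) = quotient_by L k"
      using mult_mem_transfer[OF assms(1)] by (auto simp: S_iff quotient_by_def)
    ultimately show ?thesis by simp
  qed
qed

end
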